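(* Assume that $\Omega\neq\varnothing$. Let $L_f>0$ be a Lipschitz constant of $f$ on $\mathcal X$, and let $\kappa>0$ be a constant such that $\operatorname{dist}(x,\Omega)\le\kappa R(x)$ for all $x\in\mathcal X$. If $\rho>L_f\kappa$, then the constrained problem $\min_{x\in\Omega}f(x)$ and the penalized problem $\min_{x\in\mathcal X}\Phi_\rho(x)$, where $\Phi_\rho:=f+\rho R$, have the same optimal value and the same set of global minimizers.
   Context: Model. Let $n,T\in\mathbb N=\{1,2,\dots\}$. Let $X:=\{z\in\mathbb R^n:\sum_{i=1}^n z_i=1,\ z_i\ge 0,\ i=1,\dots,n\}$ and $\mathcal X:=X^T\subset(\mathbb R^n)^T\cong\mathbb R^{nT}$; elements are written $x=(x^1,\dots,x^T)$ with blocks $x^t\in\mathbb R^n$, and $\|\cdot\|$ is the Euclidean norm. Fix $w_{\mathrm{prev}}\in X$. For each $t=1,\dots,T$ let $S_t\in\mathbb N$ and let $\xi^t$ be a discrete random vector taking values $\xi^t_j\in\mathbb R^n$ with probabilities $p^t_j>0$, $j=1,\dots,S_t$, $\sum_{j=1}^{S_t}p^t_j=1$; put $\mu^t:=\sum_{j=1}^{S_t}p_j^t\xi_j^t$. Fix $\alpha\in(0,1)$, $\lambda_1>0$, $\lambda_2>0$, $c_i\ge 0$ ($i=1,\dots,n$), and $\tau\in\mathbb R$. For a real random variable $L$, $\operatorname{VaR}_\alpha(L):=\inf\{u\in\mathbb R:\mathbb P(L\le u)\ge\alpha\}$. Objective: $f(x):=-\sum_{t=1}^T(\mu^t)^\top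 x^t+\lambda_1\Big[\sum_{i=1}^n c_i|x_i^1-(w_{\mathrm{prev}})_i|+\sum_{t=2}^T\sum_{i=1}^n c_i|x_i^t-x_i^{t-1}|\Big]+\lambda_2\sum_{t=1}^T\|x^t\|^2$. Feasible set: $\Omega:=\{x\in\mathcal X:\operatorname{VaR}_\alpha(-(\xi^t)^\top x^t)\le\tau,\ t=1,\dots,T\}$. Aggregate violation: $R(x):=\sum_{t=1}^T\big(\operatorname{VaR}_\alpha(-(\xi^t)^\top x^t)-\tau\big)_+$, where $(a)_+:=\max\{a,0\}$. For $\rho>0$, $\Phi_\rho(x):=f(x)+\rho R(x)$, $x\in\mathcal X$. For nonempty $C$, $\operatorname{dist}(x,C):=\inf_{y\in C}\|x-y\|$. *)

theory Defs
  imports "HOL-Probability.Probability"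
begin

definition portfolio_simplex :: "(real ^ 'n) set" where
  "portfolio_simplex = {z. (\<Sum>i\<in>UNIV. z $ i) = 1 \<and> (\<forall>i. z $ i \<ge> 0)}"

(* The T periods are the elements of a finite linearly ordered type 't, so T = CARD('t) and
   the space of all x = (x^1, ..., x^T) is real ^ 'n ^ 't; its library norm is the Euclidean
   norm on R^(nT). The smallest element of 't is period 1. *)

definition decision_space :: "(real ^ 'n ^ 't) set" where
  "decision_space = {x. \<forall>t. x $ t \<in> portfolio_simplex}"

definition first_period :: "'t :: {finite, linorder}" where
  "first_period = Min UNIV"

(* The period t - 1; only meaningful for t \<noteq> first_period. *)
definition prev_period :: "'t \<Rightarrow> 't :: {finite, linorder}" where
  "prev_period t = Max {s. s < t}"

(* The random vector X takes the values v 1, ..., v S with probabilities p 1, ..., p S.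
   The v j need not be distinct; the probabilities of coinciding values add up. *)
definition discrete_random_vector ::
  "'w measure \<Rightarrow> ('w \<Rightarrow> real ^ 'n) \<Rightarrow> nat \<Rightarrow> (nat \<Rightarrow> real ^ 'n) \<Rightarrow> (nat \<Rightarrow> real) \<Rightarrow> bool" where
  "discrete_random_vector M X S v p \<longleftrightarrow>
     X \<in> borel_measurable M \<and> S \<ge> 1 \<and>
     (\<forall>j\<in>{1..S}. p j > 0) \<and> (\<Sum>j=1..S. p j) = 1 \<and>
     (\<forall>A\<in>sets borel. \<P>(\<omega> in M. X \<omega> \<in> A) = (\<Sum>j\<in>{j\<in>{1..S}. v j \<in> A}. p j))"

definition scenario_mean :: "nat \<Rightarrow> (nat \<Rightarrow> real ^ 'n) \<Rightarrow> (nat \<Rightarrow> real) \<Rightarrow> real ^ 'n" where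
  "scenario_mean S v p = (\<Sum>j=1..S. p j *\<^sub>R v j)"

definition VaR :: "'w measure \<Rightarrow> real \<Rightarrow> ('w \<Rightarrow> real) \<Rightarrow> real" where
  "VaR M \<alpha> L = Inf {u. \<P>(\<omega> in M. L \<omega> \<le> u) \<ge> \<alpha>}"

definition objective ::
  "('t \<Rightarrow> real ^ 'n) \<Rightarrow> real ^ 'n \<Rightarrow> ('n \<Rightarrow> real) \<Rightarrow> real \<Rightarrow> real \<Rightarrow>
   real ^ 'n ^ 't :: {finite, linorder} \<Rightarrow> real" where
  "objective \<mu> w_prev c lam1 lam2 x =
     - (\<Sum>t\<in>UNIV. \<mu> t \<bullet> x $ t)
     + lam1 * ((\<Sum>i\<in>UNIV. c i * \<bar>x $ first_period $ i - w_prev $ i\<bar>)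
            + (\<Sum>t\<in>UNIV - {first_period}. \<Sum>i\<in>UNIV. c i * \<bar>x $ t $ i - x $ prev_period t $ i\<bar>))
     + lam2 * (\<Sum>t\<in>UNIV. (norm (x $ t))\<^sup>2)"

definition feasible_set ::
  "'w measure \<Rightarrow> ('t \<Rightarrow> 'w \<Rightarrow> real ^ 'n) \<Rightarrow> real \<Rightarrow> real \<Rightarrow> (real ^ 'n ^ 't) set" where
  "feasible_set M \<xi> \<alpha> \<tau> =
     {x \<in> decision_space. \<forall>t. VaR M \<alpha> (\<lambda>\<omega>. - (\<xi> t \<omega> \<bullet> x $ t)) \<le> \<tau>}"

definition violation ::
  "'w measure \<Rightarrow> ('t \<Rightarrow> 'w \<Rightarrow> real ^ 'n) \<Rightarrow> real \<Rightarrow> real \<Rightarrow> real ^ 'n ^ 't \<Rightarrow> real" where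
  "violation M \<xi> \<alpha> \<tau> x =
     (\<Sum>t\<in>UNIV. max (VaR M \<alpha> (\<lambda>\<omega>. - (\<xi> t \<omega> \<bullet> x $ t)) - \<tau>) 0)"

definition optimal_value :: "('a \<Rightarrow> real) \<Rightarrow> 'a set \<Rightarrow> ereal" where
  "optimal_value g C = (INF x\<in>C. ereal (g x))"

definition global_minimizers :: "('a \<Rightarrow> real) \<Rightarrow> 'a set \<Rightarrow> 'a set" where
  "global_minimizers g C = {x. is_arg_min g (\<lambda>y. y \<in> C) x}"

end

(* Let x be admissible but infeasible. Since L * infdist x C <= L * kappa * R x < rho * R x, some
   feasible y already has L * dist x y < rho * R x, and the Lipschitz bound gives
   f y < f x + rho * R x. So every infeasible point is strictly beaten by a feasible one, on which
   the penalty vanishes. Working with such a near-projection y instead of a nearest point avoids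
   any closedness of the feasible set. *)
theory Submission
  imports Defs
begin

text \<open>The metric core, free of portfolio data: the model enters only through the sign pattern
  of \<open>R\<close>, the Lipschitz bound and the error bound.\<close>

lemma exact_penalty:
  fixes f R :: "'a :: metric_space \<Rightarrow> real"
  assumes "C \<subseteq> X" and "C \<noteq> {}"
    and R_zero: "\<And>x. x \<in> C \<Longrightarrow> R x = 0"
    and R_pos: "\<And>x. x \<in> X - C \<Longrightarrow> R x > 0"
    and "L > 0" and lip: "L-lipschitz_on X f"
    and bound: "\<And>x. x \<in> X \<Longrightarrow> infdist x C \<le> \<kappa> * R x"
    and "\<rho> > L * \<kappa>"
  shows "optimal_value f C = optimal_value (\<lambda>x. f x + \<rho> * R x) X"
    and "global_minimizers f C = global_minimizers (\<lambda>x. f x + \<rho> * R x) X"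
proof -
  have beaten: "\<exists>y\<in>C. f y < f x + \<rho> * R x" if x: "x \<in> X - C" for x
  proof -
    have "L * infdist x C \<le> L * \<kappa> * R x"
      using bound[of x] x \<open>L > 0\<close> by (simp add: mult.assoc)
    \<comment> \<open>Strictness comes from \<open>R x > 0\<close>, which is available because
      \<open>x\<close> lies outside \<open>C\<close>.\<close>
    also have "\<dots> < \<rho> * R x"
      using R_pos[OF x] \<open>\<rho> > L * \<kappa>\<close> by simp
    finally have "infdist x C < \<rho> * R x / L"
      using \<open>L > 0\<close> by (simp add: field_simps)
    \<comment> \<open>As \<open>C\<close> is nonempty, \<open>infdist x C\<close> is a genuine
      infimum, so some distance already lies below any strictly larger bound.\<close>
    then obtain y where y: "y \<in> C" "dist x y < \<rho> * R x / L"
      using \<open>C \<noteq> {}\<close> cInf_lessD[of "dist x ` C"] by (auto simp: infdist_def)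
    have "f y - f x \<le> dist (f x) (f y)"
      by (simp add: dist_real_def)
    also have "\<dots> \<le> L * dist x y"
      using lipschitz_onD[OF lip] x y(1) \<open>C \<subseteq> X\<close> by blast
    also have "\<dots> < \<rho> * R x"
      using y(2) \<open>L > 0\<close> by (simp add: field_simps)
    finally show ?thesis
      using y(1) by (intro bexI[of _ y]) auto
  qed
  \<comment> \<open>The weak version covers all of \<open>X\<close>: a point of \<open>C\<close> is
    its own witness.\<close>
  have dominated: "\<exists>y\<in>C. f y \<le> f x + \<rho> * R x" if "x \<in> X" for x
    using beaten[of x] R_zero[of x] that by (cases "x \<in> C") (force intro: less_imp_le)+
  show "optimal_value f C = optimal_value (\<lambda>x. f x + \<rho> * R x) X"
    unfolding optimal_value_def
  \<comment> \<open>Infima in \<open>ereal\<close> need no lower bound, so matching each point of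
    one problem with a point of the other that is no worse suffices.\<close>
  proof (rule antisym)
    show "(INF x\<in>C. ereal (f x)) \<le> (INF x\<in>X. ereal (f x + \<rho> * R x))"
      using dominated by (intro INF_mono) auto
    show "(INF x\<in>X. ereal (f x + \<rho> * R x)) \<le> (INF x\<in>C. ereal (f x))"
      using \<open>C \<subseteq> X\<close> R_zero by (intro INF_mono) (metis add.right_neutral mult_zero_right order_refl subsetD)
  qed
  show "global_minimizers f C = global_minimizers (\<lambda>x. f x + \<rho> * R x) X"
  proof (intro set_eqI iffI)
    fix x assume "x \<in> global_minimizers f C"
    then have "x \<in> C" and "\<And>y. y \<in> C \<Longrightarrow> f x \<le> f y"
      by (auto simp: global_minimizers_def is_arg_min_linorder)
    \<comment> \<open>For \<open>z\<close> in \<open>X\<close>, \<open>dominated\<close> gives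
      \<open>y\<close> in \<open>C\<close> with
      \<open>f x \<le> f y \<le> f z + \<rho> * R z\<close>, and \<open>R x = 0\<close>.\<close>
    then show "x \<in> global_minimizers (\<lambda>x. f x + \<rho> * R x) X"
      using dominated R_zero \<open>C \<subseteq> X\<close>
      by (fastforce simp: global_minimizers_def is_arg_min_linorder)
  next
    fix x assume "x \<in> global_minimizers (\<lambda>x. f x + \<rho> * R x) X"
    then have "x \<in> X" and min: "\<And>y. y \<in> X \<Longrightarrow> f x + \<rho> * R x \<le> f y + \<rho> * R y"
      by (auto simp: global_minimizers_def is_arg_min_linorder)
    have le: "f x + \<rho> * R x \<le> f y" if "y \<in> C" for y
      using min[of y] R_zero[OF that] that \<open>C \<subseteq> X\<close> by auto
    \<comment> \<open>Otherwise \<open>beaten\<close> would supply a point of \<open>C\<close>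
      contradicting \<open>le\<close>; here the strict inequality is essential.\<close>
    then have "x \<in> C"
      using beaten[of x] \<open>x \<in> X\<close> by (meson DiffI not_less)
    then show "x \<in> global_minimizers f C"
      using le R_zero by (simp add: global_minimizers_def is_arg_min_linorder)
  qed
qed

lemma violation_nonneg: "violation M \<xi> \<alpha> \<tau> x \<ge> 0"
  by (simp add: violation_def sum_nonneg)

text \<open>A sum of positive parts vanishes only if each part does, that is, if every period meets
  its VaR bound.\<close>

lemma feasible_set_eq_zero_violation:
  "feasible_set M \<xi> \<alpha> \<tau> = {x \<in> decision_space. violation M \<xi> \<alpha> \<tau> x = 0}"
  by (auto simp: feasible_set_def violation_def sum_nonneg_eq_0_iff max_def split: if_splits)

theorem theorem3p2:
  fixes M :: "'w measure"
    and \<xi> :: "'t :: {finite, linorder} \<Rightarrow> 'w \<Rightarrow> real ^ 'n"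
    and S :: "'t \<Rightarrow> nat"
    and v :: "'t \<Rightarrow> nat \<Rightarrow> real ^ 'n"
    and p :: "'t \<Rightarrow> nat \<Rightarrow> real"
    and w_prev :: "real ^ 'n"
    and c :: "'n \<Rightarrow> real"
    and \<alpha> lam1 lam2 \<tau> L\<^sub>f \<kappa> \<rho> :: real
    and f R \<Phi> :: "real ^ 'n ^ 't :: {finite, linorder} \<Rightarrow> real"
    and \<Omega> :: "(real ^ 'n ^ 't :: {finite, linorder}) set"
  assumes "prob_space M"
    and "\<And>t. discrete_random_vector M (\<xi> t) (S t) (v t) (p t)"
    and "w_prev \<in> portfolio_simplex"
    and "0 < \<alpha>" and "\<alpha> < 1"
    and "lam1 > 0" and "lam2 > 0"
    and "\<And>i. c i \<ge> 0"
    and f: "f = objective (\<lambda>t. scenario_mean (S t) (v t) (p t)) w_prev c lam1 lam2"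
    and \<Omega>: "\<Omega> = feasible_set M \<xi> \<alpha> \<tau>"
    and R: "R = violation M \<xi> \<alpha> \<tau>"
    and \<Phi>: "\<Phi> = (\<lambda>x. f x + \<rho> * R x)"
    and "\<Omega> \<noteq> {}"
    and "L\<^sub>f > 0" and "L\<^sub>f-lipschitz_on decision_space f"
    and "\<kappa> > 0" and "\<And>x. x \<in> decision_space \<Longrightarrow> infdist x \<Omega> \<le> \<kappa> * R x"
    and "\<rho> > L\<^sub>f * \<kappa>"
  shows "optimal_value f \<Omega> = optimal_value \<Phi> decision_space \<and>
         global_minimizers f \<Omega> = global_minimizers \<Phi> decision_space"
proof -
  have "\<Omega> \<subseteq> decision_space" and "\<And>x. x \<in> \<Omega> \<Longrightarrow> R x = 0"
    by (auto simp: \<Omega> R feasible_set_eq_zero_violation)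
  moreover have "R x > 0" if "x \<in> decision_space - \<Omega>" for x
    using that violation_nonneg[of M \<xi> \<alpha> \<tau> x]
    by (auto simp: \<Omega> R feasible_set_eq_zero_violation)
  ultimately show ?thesis
    unfolding \<Phi> using exact_penalty[of \<Omega> decision_space R "L\<^sub>f" f \<kappa> \<rho>] assms by blast
qed

end
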